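(* Let $R$ be a nonzero (not necessarily unital) ring, let $\sigma : R \to R$ be a ring endomorphism and let $\delta : R \to R$ be a $\sigma$-derivation. Then the non-unital Ore extension $R[x;\sigma,\delta]$ is an associative ring.
   Context: The coefficient ring $R$ is associative but not necessarily unital; a ring endomorphism is an additive and multiplicative map. A $\sigma$-derivation is an additive map $\delta : R \to R$ with $\delta(rs) = \sigma(r)\delta(s) + \delta(r)s$ for all $r,s \in R$. Non-unital Ore extension: $R[x;\sigma,\delta]$ is the set of formal polynomials $r_0 + \sum_{i=1}^n r_i x^i$ with $r_i \in R$ (coefficients on the left; $x^i$ is a placeholder and need not itself be an element), with coefficientwise addition and with the biadditive multiplication determined by $(a x^n)(b x^m) = \sum_{i=0}^n a\,\pi_i^n(b)\, x^{i+m}$ for $a,b\in R$ and $n,m \geq 0$, where $r x^0$ means the constant $r \in R$. Here $\pi_i^n : R \to R$ is the sum of all $\binom{n}{i}$ possible compositions of $i$ copies of $\sigma$ and $n-i$ copies of $\delta$ in arbitrary order (e.g. $\pi_1^2 = \sigma\circ\delta + \delta\circ\sigma$, and $\pi_0^0 = \mathrm{id}_R$). *)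

theory Defs
  imports "HOL-Computational_Algebra.Polynomial"
begin

text \<open>The class \<^class>\<open>ring\<close> does not require a unit.\<close>

definition ring_endomorphism :: "('a::ring \<Rightarrow> 'a) \<Rightarrow> bool" where
  "ring_endomorphism \<sigma> \<longleftrightarrow>
     additive \<sigma> \<and> (\<forall>r s. \<sigma> (r * s) = \<sigma> r * \<sigma> s)"

definition skew_derivation :: "('a::ring \<Rightarrow> 'a) \<Rightarrow> ('a \<Rightarrow> 'a) \<Rightarrow> bool" where
  "skew_derivation \<sigma> \<delta> \<longleftrightarrow>
     additive \<delta> \<and> (\<forall>r s. \<delta> (r * s) = \<sigma> r * \<delta> s + \<delta> r * s)"

text \<open>A composition of \<open>i\<close> copies of \<open>\<sigma>\<close> and \<open>n - i\<close> copies of \<open>\<delta>\<close> is encoded by a word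
  of length \<open>n\<close> over \<^typ>\<open>bool\<close> containing \<^const>\<open>True\<close> exactly \<open>i\<close> times. Words giving the
  same function are counted separately, so the sum always has \<open>n choose i\<close> terms.\<close>

definition ore_pi :: "('a::ring \<Rightarrow> 'a) \<Rightarrow> ('a \<Rightarrow> 'a) \<Rightarrow> nat \<Rightarrow> nat \<Rightarrow> 'a \<Rightarrow> 'a" where
  "ore_pi \<sigma> \<delta> n i r =
     (\<Sum>w | length w = n \<and> count_list w True = i. foldr (\<lambda>c. if c then \<sigma> else \<delta>) w r)"

text \<open>The Ore extension has the additive group of \<^typ>\<open>'a poly\<close>; only the multiplication
  differs. It is the biadditive extension of
  \<open>(a x\<^sup>n) (b x\<^sup>m) = (\<Sum>i\<le>n. a \<pi>\<^sub>i\<^sup>n(b) x\<^sup>i\<^sup>+\<^sup>m)\<close>.\<close>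

definition ore_mult :: "('a::ring \<Rightarrow> 'a) \<Rightarrow> ('a \<Rightarrow> 'a) \<Rightarrow> 'a poly \<Rightarrow> 'a poly \<Rightarrow> 'a poly" where
  "ore_mult \<sigma> \<delta> p q =
     (\<Sum>n\<le>degree p. \<Sum>m\<le>degree q. \<Sum>i\<le>n.
        monom (coeff p n * ore_pi \<sigma> \<delta> n i (coeff q m)) (i + m))"

end

theory Submission
  imports Defs
begin

text \<open>Left multiplication by \<open>x\<close> is the additive operator \<open>X\<close> sending \<open>b x\<^sup>m\<close> to
  \<open>\<sigma>(b) x\<^sup>m\<^sup>+\<^sup>1 + \<delta>(b) x\<^sup>m\<close>, and the product is \<open>p q = \<Sum>\<^sub>n p\<^sub>n X\<^sup>n(q)\<close>. The rules for
  \<open>\<sigma>(b c)\<close> and \<open>\<delta>(b c)\<close> say that \<open>X\<close> after left multiplication by \<open>b\<close> equals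
  \<open>\<sigma>(b) X + \<delta>(b)\<close>, hence \<open>X(p q) = X(p) q\<close>. So right multiplication by \<open>r\<close> commutes
  with \<open>X\<close> and with left multiplication by coefficients, which is associativity.\<close>

definition lmul_poly :: "'a::ring \<Rightarrow> 'a poly \<Rightarrow> 'a poly" where
  "lmul_poly a = map_poly ((*) a)"

definition ore_X :: "('a::ring \<Rightarrow> 'a) \<Rightarrow> ('a \<Rightarrow> 'a) \<Rightarrow> 'a poly \<Rightarrow> 'a poly" where
  "ore_X \<sigma> \<delta> p = pCons 0 (map_poly \<sigma> p) + map_poly \<delta> p"

lemma coeff_lmul_poly [simp]: "coeff (lmul_poly a p) n = a * coeff p n"
  by (simp add: lmul_poly_def coeff_map_poly)

lemma lmul_poly_monom [simp]: "lmul_poly a (monom b n) = monom (a * b) n"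
  by (rule poly_eqI) simp

lemma additive_lmul_poly: "additive (lmul_poly a)"
  by (rule additive.intro, rule poly_eqI) (simp add: algebra_simps)

lemma lmul_poly_0_left [simp]: "lmul_poly 0 p = 0"
  by (rule poly_eqI) simp

lemma lmul_poly_add_left: "lmul_poly (a + b) p = lmul_poly a p + lmul_poly b p"
  by (rule poly_eqI) (simp add: algebra_simps)

lemma lmul_poly_lmul_poly: "lmul_poly a (lmul_poly b p) = lmul_poly (a * b) p"
  by (rule poly_eqI) (simp add: mult.assoc)

text \<open>The first letter of a word is the map applied last by \<open>foldr\<close>, so this
  splitting matches one further application of \<open>X\<close>.\<close>

lemma words_Suc:
  "{w :: bool list. length w = Suc n} =
     Cons True ` {w. length w = n} \<union> Cons False ` {w. length w = n}"
proof -
  have "w \<in> Cons True ` {w. length w = n} \<union> Cons False ` {w. length w = n}"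
    if "length w = Suc n" for w :: "bool list"
    using that by (cases w; cases "hd w") auto
  then show ?thesis
    by auto
qed

lemma finite_words: "finite {w :: bool list. length w = n}"
  using finite_lists_length_eq[of "UNIV :: bool set" n] by simp

context
  fixes \<sigma> \<delta> :: "'a::ring \<Rightarrow> 'a"
  assumes endo: "ring_endomorphism \<sigma>" and deriv: "skew_derivation \<sigma> \<delta>"
begin

interpretation S: additive \<sigma>
  using endo by (simp add: ring_endomorphism_def)

interpretation D: additive \<delta>
  using deriv by (simp add: skew_derivation_def)

interpretation L: additive "lmul_poly a" for a :: 'a
  by (rule additive_lmul_poly)

private abbreviation X :: "'a poly \<Rightarrow> 'a poly" where
  "X \<equiv> ore_X \<sigma> \<delta>"

private lemma coeff_ore_X:
  "coeff (X p) n = (case n of 0 \<Rightarrow> 0 | Suc k \<Rightarrow> \<sigma> (coeff p k)) + \<delta> (coeff p n)"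
  by (simp add: ore_X_def coeff_pCons coeff_map_poly S.zero D.zero split: nat.split)

private lemma ore_X_monom: "X (monom b m) = monom (\<sigma> b) (Suc m) + monom (\<delta> b) m"
  by (simp add: ore_X_def map_poly_monom S.zero D.zero monom_Suc)

private lemma additive_ore_X_power: "additive (X ^^ n)"
proof (induction n)
  case (Suc n)
  have "X (p + q) = X p + X q" for p q
    by (rule poly_eqI) (simp add: coeff_ore_X S.add D.add split: nat.split)
  then show ?case
    using Suc by (simp add: additive_def)
qed (simp add: additive_def)

interpretation P: additive "X ^^ n" for n
  by (rule additive_ore_X_power)

interpretation X: additive X
  using P.additive_axioms[of 1] by simp

private lemma ore_X_lmul_poly:
  "X (lmul_poly b p) = lmul_poly (\<sigma> b) (X p) + lmul_poly (\<delta> b) p"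
proof (rule poly_eqI)
  have "\<sigma> (r * s) = \<sigma> r * \<sigma> s" "\<delta> (r * s) = \<sigma> r * \<delta> s + \<delta> r * s" for r s
    using endo deriv by (auto simp: ring_endomorphism_def skew_derivation_def)
  then show "coeff (X (lmul_poly b p)) n =
      coeff (lmul_poly (\<sigma> b) (X p) + lmul_poly (\<delta> b) p) n" for n
    by (simp add: coeff_ore_X algebra_simps split: nat.split)
qed

text \<open>Each of the \<open>n\<close> factors \<open>X\<close> either applies \<sigma> and raises
  the exponent by one, or applies \<delta> and keeps it. Expanding all choices gives one term per
  word.\<close>

private lemma ore_X_power_monom_words:
  "(X ^^ n) (monom b m) =
     (\<Sum>w | length w = n.
        monom (foldr (\<lambda>c. if c then \<sigma> else \<delta>) w b) (count_list w True + m))"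
proof (induction n)
  case (Suc n)
  show ?case
    by (simp add: Suc words_Suc X.sum ore_X_monom, subst sum.union_disjoint)
      (auto simp: finite_words sum.reindex sum.distrib)
qed simp

text \<open>Collecting the words by their number of letters \<sigma> turns the expansion into the
  coefficients \<open>ore_pi\<close>.\<close>

private lemma ore_X_power_monom:
  "(X ^^ n) (monom b m) = (\<Sum>i\<le>n. monom (ore_pi \<sigma> \<delta> n i b) (i + m))"
proof -
  let ?f = "\<lambda>w. foldr (\<lambda>c. if c then \<sigma> else \<delta>) w b"
  have "monom (\<Sum>w\<in>A. ?f w) k = (\<Sum>w\<in>A. monom (?f w) k)" for A k
    by (induction A rule: infinite_finite_induct) (simp_all flip: add_monom)
  \<comment> \<open>Inside each group \<open>i\<close> is replaced by the count, so that the summand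
    depends on the word alone, as \<open>sum.group\<close> requires.\<close>
  then have "(\<Sum>i\<le>n. monom (ore_pi \<sigma> \<delta> n i b) (i + m)) =
      (\<Sum>i\<le>n. \<Sum>w | w \<in> {w. length w = n} \<and> count_list w True = i.
        monom (?f w) (count_list w True + m))"
    by (auto simp: ore_pi_def intro!: sum.cong)
  also have "\<dots> = (X ^^ n) (monom b m)"
    unfolding ore_X_power_monom_words
    by (rule sum.group) (auto simp: finite_words count_le_length)
  finally show ?thesis ..
qed

text \<open>Allowing any bound \<open>N\<close> lets products whose left factors have different
  degrees be compared over one range of summation; the extra terms have coefficient 0.\<close>

private lemma ore_mult_le:
  assumes "degree p \<le> N"
  shows "ore_mult \<sigma> \<delta> p q = (\<Sum>n\<le>N. lmul_poly (coeff p n) ((X ^^ n) q))"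
proof -
  have "(X ^^ n) q = (\<Sum>m\<le>degree q. \<Sum>i\<le>n. monom (ore_pi \<sigma> \<delta> n i (coeff q m)) (i + m))" for n
    by (subst poly_as_sum_of_monoms[of q, symmetric]) (simp only: P.sum ore_X_power_monom)
  then have "ore_mult \<sigma> \<delta> p q = (\<Sum>n\<le>degree p. lmul_poly (coeff p n) ((X ^^ n) q))"
    by (simp add: ore_mult_def L.sum)
  also have "\<dots> = (\<Sum>n\<le>N. lmul_poly (coeff p n) ((X ^^ n) q))"
    using assms by (intro sum.mono_neutral_left) (auto simp: coeff_eq_0)
  finally show ?thesis .
qed

private lemma ore_mult_eq:
  "ore_mult \<sigma> \<delta> p q = (\<Sum>n\<le>degree p. lmul_poly (coeff p n) ((X ^^ n) q))"
  by (simp add: ore_mult_le)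

private lemma ore_mult_add_left:
  "ore_mult \<sigma> \<delta> (p + q) r = ore_mult \<sigma> \<delta> p r + ore_mult \<sigma> \<delta> q r"
proof -
  let ?N = "max (degree p) (degree q)"
  have "degree (p + q) \<le> ?N"
    by (rule degree_add_le_max)
  then show ?thesis
    by (simp add: ore_mult_le[where N = ?N] lmul_poly_add_left sum.distrib)
qed

private lemma ore_mult_add_right:
  "ore_mult \<sigma> \<delta> p (q + r) = ore_mult \<sigma> \<delta> p q + ore_mult \<sigma> \<delta> p r"
  by (simp add: ore_mult_eq P.add L.add sum.distrib)

interpretation M: additive "\<lambda>p. ore_mult \<sigma> \<delta> p r" for r
  by (rule additive.intro) (rule ore_mult_add_left)

private lemma ore_mult_monom:
  "ore_mult \<sigma> \<delta> (monom b m) q = lmul_poly b ((X ^^ m) q)"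
proof -
  have "ore_mult \<sigma> \<delta> (monom b m) q = (\<Sum>n\<le>m. if n = m then lmul_poly b ((X ^^ m) q) else 0)"
    \<comment> \<open>The bound \<open>m\<close> also covers \<open>b = 0\<close>, where the degree
      of the monomial is 0.\<close>
    unfolding ore_mult_le[OF degree_monom_le] by (intro sum.cong) auto
  then show ?thesis
    by simp
qed

private lemma lmul_poly_ore_mult:
  "lmul_poly a (ore_mult \<sigma> \<delta> p q) = ore_mult \<sigma> \<delta> (lmul_poly a p) q"
proof -
  \<comment> \<open>The degree can drop, since \<open>a\<close> may annihilate the leading
    coefficient; both products are therefore summed up to \<open>degree p\<close>.\<close>
  have "degree (lmul_poly a p) \<le> degree p"
    by (rule degree_le) (simp add: coeff_eq_0)
  then show ?thesis
    by (simp add: ore_mult_le[where N = "degree p"] L.sum lmul_poly_lmul_poly)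
qed

text \<open>Writing \<open>a\<close> for \<open>coeff p n\<close>, both sides are the sum over
  \<open>n\<close> of \<open>lmul_poly (\<sigma> a) ((X ^^ Suc n) q) + lmul_poly (\<delta> a) ((X ^^
  n) q)\<close>.\<close>

private lemma ore_X_ore_mult: "X (ore_mult \<sigma> \<delta> p q) = ore_mult \<sigma> \<delta> (X p) q"
proof -
  have "X p = (\<Sum>n\<le>degree p. monom (\<sigma> (coeff p n)) (Suc n) + monom (\<delta> (coeff p n)) n)"
    by (subst poly_as_sum_of_monoms[of p, symmetric]) (simp only: X.sum ore_X_monom)
  then show ?thesis
    by (simp add: ore_mult_eq[of p] X.sum ore_X_lmul_poly M.sum M.add ore_mult_monom)
qed

private lemma ore_X_power_ore_mult:
  "(X ^^ n) (ore_mult \<sigma> \<delta> p q) = ore_mult \<sigma> \<delta> ((X ^^ n) p) q"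
  by (induction n) (simp_all add: ore_X_ore_mult)

text \<open>Expanding only \<open>p\<close>, both sides become the sum over \<open>n\<close> of
  \<open>lmul_poly (coeff p n)\<close> applied to
  \<open>ore_mult \<sigma> \<delta> ((X ^^ n) q) r\<close>.\<close>

private lemma ore_mult_assoc:
  "ore_mult \<sigma> \<delta> (ore_mult \<sigma> \<delta> p q) r = ore_mult \<sigma> \<delta> p (ore_mult \<sigma> \<delta> q r)"
  by (simp add: ore_mult_eq[of p] M.sum ore_X_power_ore_mult lmul_poly_ore_mult)

lemma ring_ore_mult: "class.ring (+) (0 :: 'a poly) (-) uminus (ore_mult \<sigma> \<delta>)"
  by unfold_locales (simp_all add: ore_mult_assoc ore_mult_add_left ore_mult_add_right)

end

theorem corollary3:
  fixes \<sigma> \<delta> :: "'a::ring \<Rightarrow> 'a"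
  assumes "\<exists>r::'a. r \<noteq> 0"
    and "ring_endomorphism \<sigma>"
    and "skew_derivation \<sigma> \<delta>"
  shows "class.ring (+) (0 :: 'a poly) (-) uminus (ore_mult \<sigma> \<delta>)"
  using assms(2,3) by (rule ring_ore_mult)

end
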